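(* For integers $\nu\ge1$ and $n>\nu(3\nu+5)/2$, \[ (-1)^\nu\left(\sum_{\tau=0}^{\nu}(-1)^\tau p\!\left(n-\tfrac{\tau(3\tau+1)}{2}\right)-\sum_{\tau=0}^{\nu-1}(-1)^\tau p\!\left(n-\tfrac{\tau(3\tau+5)}{2}-1\right)\right)=p(2,3,\nu;n)+p(1,3,\nu;n). \]
   Context: $p(n)$ is the number of partitions of $n$. Definition of $M(a,m,\nu;n)$ (integers $\nu\ge0$, $1\le a<m$, $n\ge0$): for a partition $\lambda_1\ge\dots\ge\lambda_k$ of $n$ into parts $\equiv a\pmod m$, put $\ell_i=(\lambda_i-a)/m+1$ (the number of boxes of the row of $\lambda_i$ in the $m$-modular Young diagram), and let $t$ be the largest integer $0\le t\le k$ with $\ell_t\ge t+\nu+2$ (height of the $(\nu+2)$-Durfee rectangle, whose width is $t+\nu+2$). $M(a,m,\nu;n)$ counts partitions of $n$ into parts $\equiv a\pmod m$ in which each of $a,a+m,\dots,a+m\nu$ occurs at least once and $\ell_i<t+\nu+2$ for all $i>t$. Definition: $p(a,m,\nu;n)$ is the number of partitions of $n$ such that, if $\beta$ denotes the sum of the parts $\not\equiv a\pmod m$, the parts $\equiv a\pmod m$ form a partition of $n-\beta$ counted by $M(a,m,\nu;n-\beta)$. *)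

theory Defs
  imports "HOL-Library.Multiset" "HOL-Number_Theory.Cong"
begin

definition partitions :: "nat \<Rightarrow> nat multiset set" where
  "partitions n = {P. 0 \<notin># P \<and> sum_mset P = n}"

lemma size_le_sum_mset: "0 \<notin># P \<Longrightarrow> size P \<le> sum_mset (P :: nat multiset)"
  by (induction P) auto

(* Ensures that the cardinalities below are genuine counts
   (card of an infinite set would be 0). *)
lemma finite_partitions: "finite (partitions n)"
proof (rule finite_subset)
  show "partitions n \<subseteq> mset ` {xs. set xs \<subseteq> {..n} \<and> length xs \<le> n}"
  proof
    fix P assume P: "P \<in> partitions n"
    obtain xs where xs: "P = mset xs"
      by (metis ex_mset)
    have "length xs \<le> n"
      using size_le_sum_mset[of P] P by (simp add: partitions_def xs)
    moreover have "set xs \<subseteq> {..n}"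
      using P by (auto simp: partitions_def xs sum_mset_sum_list member_le_sum_list)
    ultimately show "P \<in> mset ` {xs. set xs \<subseteq> {..n} \<and> length xs \<le> n}"
      using xs by blast
  qed
  show "finite (mset ` {xs. set xs \<subseteq> {..n} \<and> length xs \<le> n})"
    by (intro finite_imageI finite_lists_length_le) simp
qed

definition p :: "nat \<Rightarrow> nat" where
  "p n = card (partitions n)"

(* part P i is the i-th largest part of P, for 1 \<le> i \<le> size P. *)
definition part :: "nat multiset \<Rightarrow> nat \<Rightarrow> nat" where
  "part P i = rev (sorted_list_of_multiset P) ! (i - 1)"

(* Number of boxes in the i-th row of the m-modular Young diagram. The division
   is exact, and the subtraction not truncated, when all parts of P are
   positive and congruent to a modulo m, with 1 \<le> a < m. *)
definition row_length :: "nat \<Rightarrow> nat \<Rightarrow> nat multiset \<Rightarrow> nat \<Rightarrow> nat" where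
  "row_length a m P i = (part P i - a) div m + 1"

(* Height of the (\<nu>+2)-Durfee rectangle; t = 0 is always admissible. *)
definition durfee_height :: "nat \<Rightarrow> nat \<Rightarrow> nat \<Rightarrow> nat multiset \<Rightarrow> nat" where
  "durfee_height a m \<nu> P =
     Max {t. t \<le> size P \<and> (t = 0 \<or> row_length a m P t \<ge> t + \<nu> + 2)}"

definition M_partitions :: "nat \<Rightarrow> nat \<Rightarrow> nat \<Rightarrow> nat \<Rightarrow> nat multiset set" where
  "M_partitions a m \<nu> n =
     {P \<in> partitions n.
        (\<forall>x \<in># P. [x = a] (mod m)) \<and>
        (\<forall>j \<le> \<nu>. a + m * j \<in># P) \<and>
        (\<forall>i. durfee_height a m \<nu> P < i \<and> i \<le> size P \<longrightarrow>
             row_length a m P i < durfee_height a m \<nu> P + \<nu> + 2)}"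

definition p_res :: "nat \<Rightarrow> nat \<Rightarrow> nat \<Rightarrow> nat \<Rightarrow> nat" where
  "p_res a m \<nu> n =
     card {P \<in> partitions n.
       let \<beta> = sum_mset {# x \<in># P. \<not> [x = a] (mod m) #}
       in {# x \<in># P. [x = a] (mod m) #} \<in> M_partitions a m \<nu> (n - \<beta>)}"

end

theory Submission
  imports Defs "HOL-Computational_Algebra.Formal_Power_Series"
begin

text \<open>
  Let \<open>h j = a + m * j\<close>, and for a partition let \<open>N k\<close> be the number of its parts that are
  congruent to \<open>a\<close> modulo \<open>m\<close> and at least \<open>h k\<close>. The Durfee condition defining \<open>p_res\<close> says
  that \<open>N (t + \<nu> + 1) = t\<close> for some \<open>t\<close>. Among the partitions containing \<open>h 0, \<dots>, h (\<nu> - 1)\<close>,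
  those with \<open>N (t + \<nu>) = t\<close> for some \<open>t\<close> are counted by \<open>p_res a m (\<nu> - 1)\<close>. Each of the others
  has a unique \<open>t\<close> such that its \<open>(t + 1)\<close>-st largest part congruent to \<open>a\<close> is \<open>h (t + \<nu>)\<close>.
  Deleting this part, adding \<open>m\<close> to each of the \<open>t\<close> larger ones and inserting \<open>h \<nu>\<close> preserves the
  sum and maps them bijectively to the partitions counted by \<open>p_res a m \<nu>\<close>. Hence
  \<open>p_res a m (\<nu> - 1) n + p_res a m \<nu> n = p (n - (h 0 + \<dots> + h (\<nu> - 1)))\<close>.
  For \<open>m = 3\<close> and \<open>a = 1, 2\<close> the subtracted sums are the pentagonal numbers. As \<open>p_res a m \<nu> n = 0\<close>
  for large \<open>\<nu>\<close>, the theorem follows by downward induction on \<open>\<nu>\<close> from Euler's pentagonal recurrence,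
  which is obtained from Shanks' finite identity.
\<close>

section \<open>Euler's pentagonal recurrence\<close>

definition bounded_partitions :: "nat \<Rightarrow> nat \<Rightarrow> nat multiset set" where
  "bounded_partitions k n = {P \<in> partitions n. \<forall>x\<in>#P. x \<le> k}"

lemma bounded_partitions_0: "bounded_partitions 0 n = (if n = 0 then {{#}} else {})"
proof -
  have "P = {#}" if "0 \<notin># P" "\<forall>x\<in>#P. x = 0" for P :: "nat multiset"
    using that by (metis multiset_nonemptyE)
  then have "bounded_partitions 0 n = {P. P = {#} \<and> n = 0}"
    by (fastforce simp: bounded_partitions_def partitions_def)
  then show ?thesis by auto
qed

lemma part_le: "P \<in> partitions n \<Longrightarrow> x \<in># P \<Longrightarrow> x \<le> n"
  by (auto simp: partitions_def dest: multi_member_split)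

lemma bounded_partitions_eq: "n \<le> k \<Longrightarrow> bounded_partitions k n = partitions n"
  unfolding bounded_partitions_def using part_le le_trans by blast

text \<open>Deleting one copy of \<open>y\<close> is the inverse. \<open>A\<close> will be an upper
  bound on the parts, or the presence of certain parts other than \<open>y\<close>.\<close>

lemma bij_betw_add_part:
  assumes "0 < (y::nat)" "\<And>P. A (add_mset y P) = A P"
  shows "bij_betw (add_mset y) {P \<in> partitions n. A P} {P \<in> partitions (n + y). A P \<and> y \<in># P}"
proof (rule bij_betw_imageI)
  show "add_mset y ` {P \<in> partitions n. A P} = {P \<in> partitions (n + y). A P \<and> y \<in># P}"
  proof (intro equalityI subsetI)
    fix P assume P: "P \<in> {P \<in> partitions (n + y). A P \<and> y \<in># P}"
    then obtain Q where "P = add_mset y Q"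
      by (auto dest: multi_member_split)
    with P assms show "P \<in> add_mset y ` {P \<in> partitions n. A P}"
      by (simp add: partitions_def)
  qed (use assms in \<open>auto simp: partitions_def\<close>)
qed (simp add: inj_on_def)

text \<open>Either \<open>Suc k\<close> does not occur as a part, or one copy of it can be
  deleted.\<close>

lemma card_bounded_partitions_Suc:
  "card (bounded_partitions (Suc k) n) = card (bounded_partitions k n) +
     (if Suc k \<le> n then card (bounded_partitions (Suc k) (n - Suc k)) else 0)"
proof -
  let ?A = "\<lambda>P. \<forall>x\<in>#P. x \<le> Suc k"
  let ?D = "{P \<in> partitions n. ?A P \<and> Suc k \<in># P}"
  have split: "bounded_partitions (Suc k) n = bounded_partitions k n \<union> ?D"
    by (auto simp: bounded_partitions_def le_Suc_eq)
  have "card (bounded_partitions (Suc k) n) = card (bounded_partitions k n) + card ?D"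
    unfolding split using finite_partitions
    by (intro card_Un_disjoint) (auto simp: bounded_partitions_def)
  moreover have "card ?D = (if Suc k \<le> n then card (bounded_partitions (Suc k) (n - Suc k)) else 0)"
  proof (cases "Suc k \<le> n")
    case True
    then show ?thesis
      using bij_betw_same_card[OF bij_betw_add_part[of "Suc k" ?A "n - Suc k"]]
      by (simp add: bounded_partitions_def)
  next
    case False
    then have "?D = {}"
      using part_le by blast
    with False show ?thesis by (simp only: card.empty if_False)
  qed
  ultimately show ?thesis by simp
qed

text \<open>This is the series \<open>1 / ((1 - X) ... (1 - X ^ k))\<close>, which enters only
  through the quotient of consecutive terms.\<close>

definition bounded_gf :: "nat \<Rightarrow> int fps" where
  "bounded_gf k = Abs_fps (\<lambda>n. int (card (bounded_partitions k n)))"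

lemma bounded_gf_0: "bounded_gf 0 = 1"
  by (rule fps_ext) (simp add: bounded_gf_def bounded_partitions_0)

lemma bounded_gf_Suc: "bounded_gf k = bounded_gf (Suc k) * (1 - fps_X ^ Suc k)"
proof (rule fps_ext)
  fix n
  show "fps_nth (bounded_gf k) n = fps_nth (bounded_gf (Suc k) * (1 - fps_X ^ Suc k)) n"
    using card_bounded_partitions_Suc[of k n]
    by (simp add: right_diff_distrib fps_X_power_mult_right_nth bounded_gf_def del: power_Suc)
qed

section \<open>Staircase sums and Shanks' identity\<close>

definition staircase :: "nat \<Rightarrow> nat \<Rightarrow> nat \<Rightarrow> nat" where
  "staircase a m k = (\<Sum>j<k. a + m * j)"

text \<open>The closed form of an arithmetic sum, cleared of division and subtraction. So
  \<open>staircase 1 1 k\<close> is the triangular number \<open>k(k+1)/2\<close>, while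
  \<open>staircase 1 3 k\<close> and \<open>staircase 2 3 k\<close> are the pentagonal numbers
  \<open>k(3k-1)/2\<close> and \<open>k(3k+1)/2\<close>.\<close>

lemma double_staircase: "2 * staircase a m k + m * k = 2 * a * k + m * k * k"
  by (induction k) (auto simp: staircase_def algebra_simps)

definition pent_sum :: "nat \<Rightarrow> int fps" where
  "pent_sum k = 1 + (\<Sum>s=1..k. (-1) ^ s * (fps_X ^ staircase 1 3 s + fps_X ^ staircase 2 3 s))"

text \<open>Let \<open>T s = (-1) ^ s * bounded_gf s * fps_X ^ (Suc s * k + staircase 1 1 (Suc
  s))\<close>. Since \<open>bounded_gf s * (1 - fps_X ^ s) = bounded_gf (s - 1)\<close> for
  \<open>s > 0\<close>, the summand is then \<open>T (s - 1) - T s\<close>; for \<open>s = 0\<close>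
  it is \<open>- T 0\<close>.\<close>

lemma shanks_telescope:
  "(\<Sum>s\<le>r. (-1) ^ s * bounded_gf s * fps_X ^ (s * k + staircase 1 1 s) *
       ((1 - fps_X ^ Suc k) * fps_X ^ s - 1))
   = - ((-1) ^ r * bounded_gf r * fps_X ^ (Suc r * k + staircase 1 1 (Suc r)))"
proof (induction r)
  case 0
  then show ?case by (simp add: bounded_gf_0 staircase_def)
next
  case (Suc r)
  define u where "u = Suc r * k + staircase 1 1 (Suc r)"
  have u: "Suc (Suc r) * k + staircase 1 1 (Suc (Suc r)) = u + Suc k + Suc r"
    by (simp add: u_def staircase_def)
  show ?case
    unfolding sum.atMost_Suc Suc.IH u unfolding u_def[symmetric] bounded_gf_Suc[of r]
    by (simp add: power_add algebra_simps)
qed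

text \<open>
  Shanks' identity, divided by \<open>(1 - X) \<cdots> (1 - X ^ k)\<close>. All terms with \<open>s > 0\<close> on the left vanish
  modulo \<open>X ^ (k + 1)\<close>.
\<close>

lemma shanks:
  "(\<Sum>s\<le>k. (-1) ^ s * bounded_gf s * fps_X ^ (s * k + staircase 1 1 s)) = bounded_gf k * pent_sum k"
proof (induction k)
  case 0
  then show ?case by (simp add: bounded_gf_0 staircase_def pent_sum_def)
next
  case (Suc k)
  define H where "H k = (\<Sum>s\<le>k. (-1) ^ s * bounded_gf s * fps_X ^ (s * k + staircase 1 1 s))" for k
  define z :: "int fps" where "z = 1 - fps_X ^ Suc k"
  \<comment> \<open>The remainder of the telescoping sum and the new summand
    \<open>s = Suc k\<close> carry the next two pentagonal exponents.\<close>
  have e1: "Suc k * k + staircase 1 1 (Suc k) = staircase 1 3 (Suc k)"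
    using double_staircase[of 1 1 "Suc k"] double_staircase[of 1 3 "Suc k"] by (simp add: algebra_simps)
  have e2: "Suc k * Suc k + staircase 1 1 (Suc k) = staircase 2 3 (Suc k)"
    using double_staircase[of 1 1 "Suc k"] double_staircase[of 2 3 "Suc k"] by (simp add: algebra_simps)
  \<comment> \<open>Replacing \<open>k\<close> by \<open>Suc k\<close> multiplies the
    \<open>s\<close>-th summand by \<open>fps_X ^ s\<close>, and \<open>z\<close> turns
    \<open>bounded_gf (Suc k)\<close> into \<open>bounded_gf k\<close>.\<close>
  have "z * H (Suc k) - H k =
      (\<Sum>s\<le>k. (-1) ^ s * bounded_gf s * fps_X ^ (s * k + staircase 1 1 s) * (z * fps_X ^ s - 1))
      + z * ((-1) ^ Suc k * bounded_gf (Suc k) * fps_X ^ staircase 2 3 (Suc k))"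
    unfolding H_def sum.atMost_Suc e2
    by (simp add: sum_distrib_left sum_subtractf[symmetric] power_add algebra_simps)
  also have "\<dots> = bounded_gf k * ((-1) ^ Suc k * (fps_X ^ staircase 1 3 (Suc k) + fps_X ^ staircase 2 3 (Suc k)))"
    unfolding z_def shanks_telescope e1 unfolding bounded_gf_Suc[of k] by (simp add: algebra_simps)
  finally have "z * H (Suc k) = bounded_gf k * (pent_sum k +
      (-1) ^ Suc k * (fps_X ^ staircase 1 3 (Suc k) + fps_X ^ staircase 2 3 (Suc k)))"
    using Suc.IH by (simp add: H_def algebra_simps)
  also have "\<dots> = bounded_gf k * pent_sum (Suc k)"
    by (simp add: pent_sum_def)
  also have "\<dots> = z * (bounded_gf (Suc k) * pent_sum (Suc k))"
    unfolding bounded_gf_Suc[of k] z_def by (simp add: algebra_simps)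
  finally have "z * H (Suc k) = z * (bounded_gf (Suc k) * pent_sum (Suc k))" .
  moreover have "fps_nth z 0 \<noteq> 0"
    by (simp add: z_def)
  then have "z \<noteq> 0" by auto
  ultimately show ?case by (simp add: H_def)
qed

text \<open>The convention that \<open>p\<close> vanishes at negative arguments; truncated
  subtraction alone would give \<open>p 0 = 1\<close> there.\<close>

definition p_shift :: "nat \<Rightarrow> nat \<Rightarrow> int" where
  "p_shift n c = (if c \<le> n then int (p (n - c)) else 0)"

text \<open>The difference of the two sums in the theorem: the \<open>s\<close>-th pair joins the
  term \<open>\<tau> = s\<close> of the first to the term \<open>\<tau> = s - 1\<close> of the
  second.\<close>

definition pent_partial :: "nat \<Rightarrow> nat \<Rightarrow> int" where
  "pent_partial n k =
     p_shift n 0 + (\<Sum>s=1..k. (-1) ^ s * (p_shift n (staircase 1 3 s) + p_shift n (staircase 2 3 s)))"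

text \<open>Compare coefficients of \<open>X ^ n\<close> in \<open>shanks\<close> for
  \<open>k = n\<close>. Up to degree \<open>n\<close>, the series \<open>bounded_gf n\<close> agrees
  with the generating function of \<open>p\<close>.\<close>

theorem pentagonal_recurrence:
  assumes "n \<ge> 1"
  shows "pent_partial n n = 0"
proof -
  have shift: "fps_nth (bounded_gf n * fps_X ^ c) n = p_shift n c" for c
    by (simp add: fps_X_power_mult_right_nth bounded_gf_def p_shift_def p_def bounded_partitions_eq)
  have "pent_partial n n = fps_nth (bounded_gf n * pent_sum n) n"
  proof -
    have "bounded_gf n * pent_sum n = bounded_gf n * fps_X ^ 0 +
       (\<Sum>s=1..n. fps_const ((-1) ^ s) * (bounded_gf n * fps_X ^ staircase 1 3 s + bounded_gf n * fps_X ^ staircase 2 3 s))"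
      by (simp add: pent_sum_def algebra_simps sum_distrib_left flip: fps_const_power fps_const_neg)
    then show ?thesis
      by (simp only: fps_add_nth fps_sum_nth fps_mult_left_const_nth shift pent_partial_def)
  qed
  also have "\<dots> = (\<Sum>s\<le>n. fps_nth ((-1) ^ s * bounded_gf s * fps_X ^ (s * n + staircase 1 1 s)) n)"
    by (simp add: shanks[symmetric] fps_sum_nth)
  \<comment> \<open>The summand \<open>s = 0\<close> is the constant 1, and
    \<open>n \<ge> 1\<close>; for \<open>s > 0\<close> the exponent exceeds
    \<open>n\<close>.\<close>
  also have "\<dots> = (\<Sum>s\<le>n. 0)"
  proof (rule sum.cong[OF refl])
    fix s
    show "fps_nth ((-1) ^ s * bounded_gf s * fps_X ^ (s * n + staircase 1 1 s)) n = 0"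
    proof (cases s)
      case 0
      then show ?thesis using assms by (simp add: bounded_gf_0 staircase_def)
    next
      case (Suc r)
      then have "n < s * n + staircase 1 1 s"
        by (simp add: staircase_def)
      then show ?thesis by (simp add: fps_X_power_mult_right_nth)
    qed
  qed
  finally show ?thesis by simp
qed

section \<open>The Durfee condition\<close>

text \<open>The \<open>N k\<close> of the outline is
  \<open>rows_ge a m P (a + m * k)\<close>.\<close>

definition rows_ge :: "nat \<Rightarrow> nat \<Rightarrow> nat multiset \<Rightarrow> nat \<Rightarrow> nat" where
  "rows_ge a m P y = size {#x \<in># P. [x = a] (mod m) \<and> y \<le> x#}"

lemma rows_ge_antimono: "y \<le> z \<Longrightarrow> rows_ge a m P z \<le> rows_ge a m P y"
  unfolding rows_ge_def by (intro size_mset_mono filter_mset_mono_strong) auto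

lemma rows_ge_le_size: "rows_ge a m P y \<le> size P"
  by (simp add: rows_ge_def size_filter_mset_lesseq)

lemma rows_ge_add: "rows_ge a m (P + Q) y = rows_ge a m P y + rows_ge a m Q y"
  by (simp add: rows_ge_def)

definition M_type :: "nat \<Rightarrow> nat \<Rightarrow> nat \<Rightarrow> nat \<Rightarrow> nat multiset set" where
  "M_type a m \<nu> n = {P \<in> partitions n. (\<forall>j\<le>\<nu>. a + m * j \<in># P) \<and>
     (\<exists>t. rows_ge a m P (a + m * (t + \<nu> + 1)) = t)}"

text \<open>In a weakly decreasing list the entries that are at least \<open>y\<close> form a
  prefix.\<close>

lemma nth_ge_iff_length_filter:
  "sorted_wrt (\<ge>) xs \<Longrightarrow> i < length xs \<Longrightarrow>
     (y::nat) \<le> xs ! i \<longleftrightarrow> i < length (filter (\<lambda>x. y \<le> x) xs)"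
proof (induction xs arbitrary: i)
  case (Cons x xs)
  show ?case
  proof (cases "y \<le> x")
    case True
    then show ?thesis using Cons by (cases i) auto
  next
    case False
    then have "filter (\<lambda>x. y \<le> x) xs = []"
      using Cons.prems by (auto simp: filter_empty_conv)
    moreover have "(x # xs) ! i \<le> x"
      using Cons.prems by (cases i) auto
    ultimately show ?thesis using False by simp
  qed
qed simp

lemma part_ge_iff:
  assumes "1 \<le> i" "i \<le> size Q"
  shows "y \<le> part Q i \<longleftrightarrow> i \<le> size {#x \<in># Q. y \<le> x#}"
proof -
  let ?xs = "rev (sorted_list_of_multiset Q)"
  have "mset ?xs = Q" by simp
  then have "size {#x \<in># Q. y \<le> x#} = length (filter (\<lambda>x. y \<le> x) ?xs)"
    by (metis mset_filter size_mset)
  moreover have "sorted_wrt (\<ge>) ?xs"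
    by (simp add: sorted_wrt_rev)
  moreover have "length ?xs = size Q"
    using \<open>mset ?xs = Q\<close> by (metis size_mset)
  ultimately show ?thesis
    unfolding part_def using nth_ge_iff_length_filter[of ?xs "i - 1" y] assms by auto
qed

lemma row_length_ge_iff:
  assumes "1 \<le> i" "i \<le> size Q" "0 < m"
  shows "t + \<nu> + 2 \<le> row_length a m Q i \<longleftrightarrow> i \<le> size {#x \<in># Q. a + m * (t + \<nu> + 1) \<le> x#}"
proof -
  have "t + \<nu> + 2 \<le> row_length a m Q i \<longleftrightarrow> t + \<nu> + 1 \<le> (part Q i - a) div m"
    by (simp add: row_length_def)
  also have "\<dots> \<longleftrightarrow> m * (t + \<nu> + 1) \<le> part Q i - a"
    using \<open>0 < m\<close> by (simp add: less_eq_div_iff_mult_less_eq mult.commute)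
  \<comment> \<open>If \<open>part Q i < a\<close>, the truncated difference is 0 and both sides
    fail, because \<open>m * (t + \<nu> + 1)\<close> is positive.\<close>
  also have "\<dots> \<longleftrightarrow> a + m * (t + \<nu> + 1) \<le> part Q i"
    using \<open>0 < m\<close> by (cases "a \<le> part Q i") auto
  finally show ?thesis using part_ge_iff assms by simp
qed

text \<open>The count \<open>f\<close> is antitone and the Durfee height \<open>d\<close> is the
  largest \<open>t\<close> with \<open>t \<le> f t\<close>. The condition on the rows below the
  rectangle says \<open>f d = d\<close>. Any fixed point \<open>t\<close> satisfies
  \<open>t \<le> d\<close>, hence \<open>d \<le> f d \<le> f t = t \<le> d\<close>.\<close>

lemma durfee_iff:
  assumes "0 < m"
  shows "(\<forall>i. durfee_height a m \<nu> Q < i \<and> i \<le> size Q \<longrightarrow>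
             row_length a m Q i < durfee_height a m \<nu> Q + \<nu> + 2) \<longleftrightarrow>
         (\<exists>t. size {#x \<in># Q. a + m * (t + \<nu> + 1) \<le> x#} = t)"
proof -
  define f where "f t = size {#x \<in># Q. a + m * (t + \<nu> + 1) \<le> x#}" for t
  define d where "d = durfee_height a m \<nu> Q"
  have f_le: "f t \<le> size Q" for t
    by (simp add: f_def size_filter_mset_lesseq)
  have f_anti: "f t \<le> f s" if "s \<le> t" for s t
  proof -
    have "a + m * (s + \<nu> + 1) \<le> a + m * (t + \<nu> + 1)"
      using that by simp
    then show ?thesis
      unfolding f_def by (intro size_mset_mono filter_mset_mono_strong) (use le_trans in blast)+
  qed
  have row: "t + \<nu> + 2 \<le> row_length a m Q i \<longleftrightarrow> i \<le> f t" if "1 \<le> i" "i \<le> size Q" for i t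
    using row_length_ge_iff[OF that assms] by (simp add: f_def)
  have set_eq: "{t. t \<le> size Q \<and> (t = 0 \<or> row_length a m Q t \<ge> t + \<nu> + 2)} = {t. t \<le> f t}"
    (is "?L = ?R")
  proof (intro equalityI subsetI)
    fix t assume "t \<in> ?L"
    then show "t \<in> ?R" using row[of t t] by (cases "t = 0") auto
  next
    fix t assume "t \<in> ?R"
    then show "t \<in> ?L" using row[of t t] f_le[of t] by (cases "t = 0") auto
  qed
  have fin: "finite {t. t \<le> f t}"
    by (rule finite_subset[of _ "{..size Q}"]) (auto intro: le_trans[OF _ f_le])
  have d: "d = Max {t. t \<le> f t}"
    by (simp only: d_def durfee_height_def set_eq)
  have "0 \<in> {t. t \<le> f t}" by simp
  then have d_in: "d \<le> f d"
    using Max_in[OF fin] d by auto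
  have d_max: "t \<le> d" if "t \<le> f t" for t
    using Max_ge[OF fin, of t] that d by auto
  have "(\<forall>i. d < i \<and> i \<le> size Q \<longrightarrow> row_length a m Q i < d + \<nu> + 2) \<longleftrightarrow> f d = d"
  proof
    assume *: "\<forall>i. d < i \<and> i \<le> size Q \<longrightarrow> row_length a m Q i < d + \<nu> + 2"
    show "f d = d"
    proof (rule ccontr)
      assume "f d \<noteq> d"
      then have "d < f d" using d_in by simp
      \<comment> \<open>Row number \<open>f d\<close> lies below the rectangle but is too
        long.\<close>
      then show False using *[rule_format, of "f d"] row[of "f d" d] f_le[of d] by simp
    qed
  next
    assume "f d = d"
    then show "\<forall>i. d < i \<and> i \<le> size Q \<longrightarrow> row_length a m Q i < d + \<nu> + 2"
      using row[of _ d] by (auto simp: not_le[symmetric])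
  qed
  also have "\<dots> \<longleftrightarrow> (\<exists>t. f t = t)"
  proof
    assume "\<exists>t. f t = t"
    then obtain t where t: "f t = t" by blast
    then have "t \<le> d" using d_max by simp
    then have "f d \<le> t" using f_anti[of t d] t by simp
    then show "f d = d" using d_in \<open>t \<le> d\<close> by simp
  qed blast
  finally show ?thesis by (simp add: d_def f_def)
qed

lemma cong_step [simp]: "[a + m * j = a] (mod (m::nat))"
  by (simp add: cong_def)

text \<open>Parts outside the residue class matter only through their sum, which is subtracted from
  \<open>n\<close>, so every condition can be read off the whole partition.\<close>

lemma p_res_eq_card_M_type:
  assumes "0 < m"
  shows "p_res a m \<nu> n = card (M_type a m \<nu> n)"
proof -
  have "{# x \<in># P. [x = a] (mod m) #} \<in> M_partitions a m \<nu> (n - sum_mset {# x \<in># P. \<not> [x = a] (mod m) #})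
      \<longleftrightarrow> P \<in> M_type a m \<nu> n" if P: "P \<in> partitions n" for P
  proof -
    let ?Q = "{# x \<in># P. [x = a] (mod m) #}" and ?R = "{# x \<in># P. \<not> [x = a] (mod m) #}"
    have "sum_mset P = sum_mset ?Q + sum_mset ?R"
      by (metis multiset_partition sum_mset.union)
    then have "?Q \<in> partitions (n - sum_mset ?R)"
      using P by (auto simp: partitions_def)
    then show ?thesis
      using P unfolding M_partitions_def M_type_def durfee_iff[OF assms]
      by (auto simp: filter_filter_mset rows_ge_def conj_commute)
  qed
  then have "{P \<in> partitions n. {# x \<in># P. [x = a] (mod m) #} \<in>
      M_partitions a m \<nu> (n - sum_mset {# x \<in># P. \<not> [x = a] (mod m) #})} = M_type a m \<nu> n"
    by (auto simp: M_type_def)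
  then show ?thesis by (simp add: p_res_def Let_def)
qed

section \<open>The bijection\<close>

definition staircase_partitions :: "nat \<Rightarrow> nat \<Rightarrow> nat \<Rightarrow> nat \<Rightarrow> nat multiset set" where
  "staircase_partitions a m \<nu> n = {P \<in> partitions n. \<forall>j<\<nu>. a + m * j \<in># P}"

text \<open>For \<open>\<nu> > 0\<close> this is the complement of
  \<open>M_type a m (\<nu> - 1) n\<close> in
  \<open>staircase_partitions a m \<nu> n\<close>.\<close>

definition no_durfee :: "nat \<Rightarrow> nat \<Rightarrow> nat \<Rightarrow> nat \<Rightarrow> nat multiset set" where
  "no_durfee a m \<nu> n = {P \<in> staircase_partitions a m \<nu> n. \<forall>t. rows_ge a m P (a + m * (t + \<nu>)) \<noteq> t}"

text \<open>
  \<open>U\<close> collects the \<open>t\<close> largest parts congruent to \<open>a\<close>, where \<open>t = size U\<close>, and \<open>V\<close> the parts left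
  after one copy of \<open>h (t + \<nu>)\<close> is deleted; further copies may lie in both \<open>U\<close> and \<open>V\<close>.
\<close>

definition split_pairs :: "nat \<Rightarrow> nat \<Rightarrow> nat \<Rightarrow> nat \<Rightarrow> (nat multiset \<times> nat multiset) set" where
  "split_pairs a m \<nu> n = {(U, V).
     (\<forall>x\<in>#U. [x = a] (mod m) \<and> a + m * (size U + \<nu>) \<le> x) \<and>
     (\<forall>x\<in>#V. [x = a] (mod m) \<longrightarrow> x \<le> a + m * (size U + \<nu>)) \<and>
     0 \<notin># V \<and> (\<forall>j<\<nu>. a + m * j \<in># V) \<and>
     sum_mset U + sum_mset V + (a + m * (size U + \<nu>)) = n}"

lemma cong_gap:
  fixes x :: nat
  assumes "[x = a] (mod m)" "a + m * k < x"
  shows "a + m * (k + 1) \<le> x"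
proof -
  have "[x = a + m * k] (mod m)"
    using assms(1) by (simp add: cong_def)
  then have "m dvd x - (a + m * k)"
    using assms(2) by (simp add: cong_altdef_nat)
  then have "m \<le> x - (a + m * k)"
    using assms(2) by (intro dvd_imp_le) auto
  then show ?thesis using assms(2) by (simp add: algebra_simps)
qed

text \<open>An antitone count without a fixed point still crosses the diagonal: exactly one
  \<open>t\<close> has \<open>N (t + 1 + \<nu>) \<le> t < N (t + \<nu>)\<close>, and it equals
  \<open>size U\<close>. Then \<open>U\<close> must consist of the class members above
  \<open>h (t + \<nu>)\<close>, filled up to size \<open>t\<close> with copies of
  \<open>h (t + \<nu>)\<close>.\<close>

lemma bij_betw_no_durfee:
  assumes "0 < a" "0 < m"
  shows "bij_betw (\<lambda>(U, V). U + {#a + m * (size U + \<nu>)#} + V) (split_pairs a m \<nu> n) (no_durfee a m \<nu> n)"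
    (is "bij_betw ?f ?X ?S")
proof -
  let ?h = "\<lambda>k. a + m * (k + \<nu>)"
  let ?B = "\<lambda>k P. {#x \<in># P. [x = a] (mod m) \<and> ?h k < x#}"
  let ?N = "rows_ge a m"
  have anti: "?N P (?h t) \<le> ?N P (?h s)" if "s \<le> t" for P s t
    using that by (intro rows_ge_antimono) simp
  have B: "size (?B k P) = ?N P (?h (Suc k))" for k P
  proof -
    have "?h k < ?h (Suc k)" using \<open>0 < m\<close> by simp
    then have "?B k P = {#x \<in># P. [x = a] (mod m) \<and> ?h (Suc k) \<le> x#}"
      using cong_gap[of _ a m "k + \<nu>"] by (intro filter_mset_cong) auto
    then show ?thesis by (simp add: rows_ge_def)
  qed
  have BV: "?B (size U) V = {#}" if "(U, V) \<in> ?X" for U V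
    using that by (auto simp: split_pairs_def)
  have Bf: "?B (size U) (?f (U, V)) = ?B (size U) U" if "(U, V) \<in> ?X" for U V
    using BV[OF that] by simp
  have crossing: "?N (?f (U, V)) (?h (Suc (size U))) \<le> size U \<and> size U < ?N (?f (U, V)) (?h (size U))"
    if "(U, V) \<in> ?X" for U V
  proof
    show "?N (?f (U, V)) (?h (Suc (size U))) \<le> size U"
      unfolding B[symmetric] Bf[OF that] by (rule size_filter_mset_lesseq)
    have "{#x \<in># U. [x = a] (mod m) \<and> ?h (size U) \<le> x#} = U"
      using that by (auto simp: split_pairs_def filter_mset_eq_conv)
    then have "?N U (?h (size U)) = size U" by (simp add: rows_ge_def)
    then show "size U < ?N (?f (U, V)) (?h (size U))"
      by (simp add: rows_ge_add) (simp add: rows_ge_def)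
  qed
  have U_eq: "U = ?B (size U) U + replicate_mset (size U - size (?B (size U) U)) (?h (size U))"
    if "(U, V) \<in> ?X" for U V
  proof -
    define k where "k = size U"
    have U: "\<forall>x\<in>#U. [x = a] (mod m) \<and> ?h k \<le> x"
      using that by (simp add: split_pairs_def k_def)
    have "U = ?B k U + {#x \<in># U. \<not> ([x = a] (mod m) \<and> ?h k < x)#}"
      by (rule multiset_partition)
    also have "{#x \<in># U. \<not> ([x = a] (mod m) \<and> ?h k < x)#} = {#x \<in># U. x = ?h k#}"
      using U by (intro filter_mset_cong) auto
    also have "\<dots> = replicate_mset (count U (?h k)) (?h k)"
      by (metis filter_eq_replicate_mset)
    finally have eq: "U = ?B k U + replicate_mset (count U (?h k)) (?h k)" .
    then have "size U = size (?B k U) + count U (?h k)"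
      by (metis size_union size_replicate_mset)
    then have "count U (?h k) = size U - size (?B k U)" by simp
    then show ?thesis using eq unfolding k_def by metis
  qed
  show ?thesis
  proof (rule bij_betw_imageI)
    show "inj_on ?f ?X"
    proof (rule inj_onI, clarify)
      fix U V U' V'
      assume X: "(U, V) \<in> ?X" and X': "(U', V') \<in> ?X"
        and eq: "U + {#?h (size U)#} + V = U' + {#?h (size U')#} + V'"
      then have eqf: "?f (U, V) = ?f (U', V')" by simp
      have "\<not> size U < size U'"
        \<comment> \<open>Two crossings \<open>t < t'\<close> would give
          \<open>t' < N (t' + \<nu>) \<le> N (t + 1 + \<nu>) \<le> t\<close>.\<close>
        using crossing[OF X] crossing[OF X'] eqf anti[of "Suc (size U)" "size U'" "?f (U, V)"] by auto
      moreover have "\<not> size U' < size U"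
        using crossing[OF X] crossing[OF X'] eqf anti[of "Suc (size U')" "size U" "?f (U, V)"] by auto
      ultimately have s: "size U = size U'" by simp
      have "?B (size U) U = ?B (size U) U'"
        using Bf[OF X] Bf[OF X'] eqf s by metis
      then have "U = U'"
        using U_eq[OF X] U_eq[OF X'] s by metis
      with eq s show "U = U' \<and> V = V'" by simp
    qed
    show "?f ` ?X = ?S"
    proof (intro equalityI subsetI)
      fix P assume "P \<in> ?f ` ?X"
      then obtain U V where X: "(U, V) \<in> ?X" and P: "P = ?f (U, V)" by auto
      have "?N P (?h t) \<noteq> t" for t
      proof (cases "t \<le> size U")
        case True
        then show ?thesis using crossing[OF X] anti[of t "size U" P] P by simp
      next
        case False
        then show ?thesis using crossing[OF X] anti[of "Suc (size U)" t P] P by simp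
      qed
      moreover have "P \<in> partitions n" "\<forall>j<\<nu>. a + m * j \<in># P"
        using X assms by (auto simp: P split_pairs_def partitions_def)
      ultimately show "P \<in> ?S" by (simp add: no_durfee_def staircase_partitions_def)
    next
      fix P assume P: "P \<in> ?S"
      have ex: "?N P (?h (Suc (size P))) \<le> size P"
        by (rule rows_ge_le_size)
      define t where "t = (LEAST t. ?N P (?h (Suc t)) \<le> t)"
      have t1: "?N P (?h (Suc t)) \<le> t"
        unfolding t_def by (rule LeastI[of "\<lambda>t. ?N P (?h (Suc t)) \<le> t", OF ex])
      have ne: "?N P (?h t) \<noteq> t" using P by (auto simp: no_durfee_def)
      \<comment> \<open>Minimality of \<open>t\<close> gives \<open>t \<le> ?N P (?h t)\<close>, and
        equality is excluded by \<open>ne\<close>.\<close>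
      have t2: "t < ?N P (?h t)"
      proof (cases t)
        case 0
        then show ?thesis using ne by simp
      next
        case (Suc s)
        then have "\<not> ?N P (?h (Suc s)) \<le> s"
          using not_less_Least[of s "\<lambda>t. ?N P (?h (Suc t)) \<le> t"] by (simp add: t_def)
        then show ?thesis using ne Suc by simp
      qed
      define b where "b = size (?B t P)"
      have b: "b \<le> t" using t1 B by (simp add: b_def)
      have "{#x \<in># P. [x = a] (mod m) \<and> ?h t \<le> x#} = ?B t P + replicate_mset (count P (?h t)) (?h t)"
        by (rule multiset_eqI) auto
      then have "?N P (?h t) = b + count P (?h t)"
        by (simp add: rows_ge_def b_def)
      \<comment> \<open>Of these copies, \<open>t - b\<close> fill up \<open>U\<close> and one more
        is the part to be deleted.\<close>
      then have cnt: "Suc (t - b) \<le> count P (?h t)" using t2 b by simp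
      define U where "U = ?B t P + replicate_mset (t - b) (?h t)"
      define V where "V = P - (U + {#?h t#})"
      have sU: "size U = t" using b by (simp add: U_def b_def[symmetric])
      have "U + {#?h t#} \<subseteq># P"
        using cnt by (auto simp: subseteq_mset_def U_def)
      then have P_eq: "P = U + {#?h t#} + V"
        unfolding V_def by (rule subset_mset.add_diff_inverse[symmetric])
      have PP: "0 \<notin># P" "sum_mset P = n" "\<forall>j<\<nu>. a + m * j \<in># P"
        using P by (auto simp: no_durfee_def staircase_partitions_def partitions_def)
      have "(U, V) \<in> ?X"
        unfolding split_pairs_def mem_Collect_eq prod.case sU
      proof (intro conjI)
        show "\<forall>x\<in>#U. [x = a] (mod m) \<and> ?h t \<le> x"
          by (auto simp: U_def)
        show "\<forall>x\<in>#V. [x = a] (mod m) \<longrightarrow> x \<le> ?h t"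
        proof (intro ballI impI, rule ccontr)
          fix x assume x: "x \<in># V" "[x = a] (mod m)" "\<not> x \<le> ?h t"
          then have "count U x = count P x" by (simp add: U_def)
          then have "count V x = 0" by (simp add: V_def)
          with x show False by (simp add: not_in_iff[symmetric])
        qed
        show "0 \<notin># V" using PP(1) unfolding P_eq by simp
        show "\<forall>j<\<nu>. a + m * j \<in># V"
        proof (intro allI impI)
          fix j assume j: "j < \<nu>"
          then have lt: "a + m * j < ?h t" using \<open>0 < m\<close> by simp
          then have "count U (a + m * j) = 0" by (simp add: U_def)
          then have "a + m * j \<notin># U" by (simp add: not_in_iff)
          moreover have "a + m * j \<in># U + {#?h t#} + V" using PP(3) j P_eq by metis
          ultimately show "a + m * j \<in># V" using lt by auto
        qed
        show "sum_mset U + sum_mset V + ?h t = n"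
          using arg_cong[OF P_eq, of sum_mset] PP(2) by simp
      qed
      moreover have "P = ?f (U, V)" using P_eq sU by simp
      ultimately show "P \<in> ?f ` ?X" by blast
    qed
  qed
qed

text \<open>After the shift by \<open>m\<close>, the members of \<open>U\<close> are exactly the
  class members that are at least \<open>h (t + \<nu> + 1)\<close>, where \<open>t = size U\<close>,
  so \<open>t\<close> is a fixed point and \<open>U\<close> can be recovered. The sum is kept
  because \<open>m * t + h \<nu> = h (t + \<nu>)\<close>.\<close>

lemma bij_betw_M_type:
  assumes "0 < a" "0 < m"
  shows "bij_betw (\<lambda>(U, V). image_mset (\<lambda>x. x + m) U + V + {#a + m * \<nu>#}) (split_pairs a m \<nu> n) (M_type a m \<nu> n)"
    (is "bij_betw ?g ?X ?T")
proof -
  let ?h = "\<lambda>k. a + m * (k + \<nu> + 1)"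
  let ?B = "\<lambda>k P. {#x \<in># P. [x = a] (mod m) \<and> ?h k \<le> x#}"
  have cong_add: "[x + m = a] (mod m) \<longleftrightarrow> [x = a] (mod m)" for x
    by (simp add: cong_def)
  have Bg: "?B (size U) (?g (U, V)) = image_mset (\<lambda>x. x + m) U" if "(U, V) \<in> ?X" for U V
  proof -
    have "?B (size U) (image_mset (\<lambda>x. x + m) U) = image_mset (\<lambda>x. x + m) U"
      using that by (auto simp: split_pairs_def filter_mset_eq_conv cong_add algebra_simps)
    moreover have "?h (size U) > a + m * (size U + \<nu>)" "?h (size U) > a + m * \<nu>"
      using \<open>0 < m\<close> by (auto simp: algebra_simps)
    then have "?B (size U) V = {#}" "?B (size U) {#a + m * \<nu>#} = {#}"
      using that by (fastforce simp: split_pairs_def)+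
    ultimately show ?thesis by (simp only: prod.case filter_union_mset add_0_right)
  qed
  have Ng: "rows_ge a m (?g (U, V)) (?h (size U)) = size U" if "(U, V) \<in> ?X" for U V
    using Bg[OF that] by (simp add: rows_ge_def)
  show ?thesis
  proof (rule bij_betw_imageI)
    show "inj_on ?g ?X"
    proof (rule inj_onI, clarify)
      fix U V U' V'
      assume X: "(U, V) \<in> ?X" and X': "(U', V') \<in> ?X"
        and eq: "image_mset (\<lambda>x. x + m) U + V + {#a + m * \<nu>#} = image_mset (\<lambda>x. x + m) U' + V' + {#a + m * \<nu>#}"
      then have eqg: "?g (U, V) = ?g (U', V')" by simp
      have anti: "rows_ge a m P (?h t) \<le> rows_ge a m P (?h s)" if "s \<le> t" for P s t
        using that by (intro rows_ge_antimono) simp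
      \<comment> \<open>An antitone function has at most one fixed point.\<close>
      have s: "size U = size U'"
        using Ng[OF X] Ng[OF X'] eqg anti[of "size U" "size U'" "?g (U, V)"]
          anti[of "size U'" "size U" "?g (U, V)"] by (cases "size U \<le> size U'") auto
      have "image_mset (\<lambda>x. x + m) U = image_mset (\<lambda>x. x + m) U'"
        using Bg[OF X] Bg[OF X'] eqg s by metis
      moreover from this have "image_mset (\<lambda>x. x - m) (image_mset (\<lambda>x. x + m) U) =
          image_mset (\<lambda>x. x - m) (image_mset (\<lambda>x. x + m) U')" by (rule arg_cong)
      then have "U = U'"
        by (simp add: image_mset.compositionality comp_def)
      ultimately show "U = U' \<and> V = V'" using eq by simp
    qed
    show "?g ` ?X = ?T"
    proof (intro equalityI subsetI)
      fix P assume "P \<in> ?g ` ?X"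
      then obtain U V where X: "(U, V) \<in> ?X" and P: "P = ?g (U, V)" by auto
      have "sum_mset (image_mset (\<lambda>x. x + m) U) = sum_mset U + m * size U"
        by (induction U) auto
      then have "P \<in> partitions n" 
        using X assms by (auto simp: P split_pairs_def partitions_def algebra_simps)
      moreover have "\<forall>j\<le>\<nu>. a + m * j \<in># P"
        using X by (auto simp: P split_pairs_def le_less)
      ultimately show "P \<in> ?T" using Ng[OF X] P by (auto simp: M_type_def)
    next
      fix P assume P: "P \<in> ?T"
      then obtain t where t: "rows_ge a m P (?h t) = t" by (auto simp: M_type_def)
      define W where "W = ?B t P"
      define U where "U = image_mset (\<lambda>x. x - m) W"
      \<comment> \<open>Only the inserted copy of \<open>h \<nu>\<close> is taken away; any others
        stay in \<open>V\<close>.\<close>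
      define V where "V = {#x \<in># P. \<not> ([x = a] (mod m) \<and> ?h t \<le> x)#} - {#a + m * \<nu>#}"
      have sU: "size U = t" using t by (simp add: U_def W_def rows_ge_def)
      have PP: "0 \<notin># P" "sum_mset P = n" "\<And>j. j \<le> \<nu> \<Longrightarrow> a + m * j \<in># P"
        using P by (auto simp: M_type_def partitions_def)
      have W_ge: "m \<le> x" if "x \<in># W" for x
        using that by (auto simp: W_def algebra_simps)
      have "image_mset (\<lambda>x. x + m) U = image_mset (\<lambda>x. x - m + m) W"
        by (simp add: U_def image_mset.compositionality comp_def)
      also have "\<dots> = image_mset (\<lambda>x. x) W"
        using W_ge by (intro image_mset_cong) simp
      finally have W: "image_mset (\<lambda>x. x + m) U = W" by simp
      have low: "a + m * j \<in># {#x \<in># P. \<not> ([x = a] (mod m) \<and> ?h t \<le> x)#}" if "j \<le> \<nu>" for j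
      proof -
        have "m * j < m * (t + \<nu> + 1)" using that \<open>0 < m\<close> by (intro mult_strict_left_mono) auto
        then show ?thesis using PP(3)[OF that] by simp
      qed
      have "P = W + {#x \<in># P. \<not> ([x = a] (mod m) \<and> ?h t \<le> x)#}"
        unfolding W_def by (rule multiset_partition)
      also have "\<dots> = image_mset (\<lambda>x. x + m) U + V + {#a + m * \<nu>#}"
        using low[of \<nu>] by (simp add: V_def W)
      finally have P_eq: "P = image_mset (\<lambda>x. x + m) U + V + {#a + m * \<nu>#}" .
      have sumU: "sum_mset (image_mset (\<lambda>x. x + m) U) = sum_mset U + m * size U"
        by (induction U) auto
      have "(U, V) \<in> ?X"
        unfolding split_pairs_def mem_Collect_eq prod.case sU
      proof (intro conjI)
        show "\<forall>x\<in>#U. [x = a] (mod m) \<and> a + m * (t + \<nu>) \<le> x"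
        proof
          fix x assume "x \<in># U"
          then have "x + m \<in># W" unfolding W[symmetric] by simp
          then show "[x = a] (mod m) \<and> a + m * (t + \<nu>) \<le> x"
            using cong_add[of x] by (simp add: W_def algebra_simps)
        qed
        show "\<forall>x\<in>#V. [x = a] (mod m) \<longrightarrow> x \<le> a + m * (t + \<nu>)"
        proof (intro ballI impI, rule ccontr)
          fix x assume x: "x \<in># V" "[x = a] (mod m)" "\<not> x \<le> a + m * (t + \<nu>)"
          then have "?h t \<le> x" using cong_gap[of x a m "t + \<nu>"] by simp
          moreover have "\<not> ([x = a] (mod m) \<and> ?h t \<le> x)"
            using in_diffD[OF x(1)[unfolded V_def]] by simp
          ultimately show False using x by simp
        qed
        show "0 \<notin># V" using PP(1) unfolding P_eq by simp
        show "\<forall>j<\<nu>. a + m * j \<in># V"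
          using low \<open>0 < m\<close> by (auto simp: V_def in_diff_count)
        show "sum_mset U + sum_mset V + (a + m * (t + \<nu>)) = n"
          using arg_cong[OF P_eq, of sum_mset] PP(2) sU sumU by (simp add: algebra_simps)
      qed
      moreover have "P = ?g (U, V)" using P_eq by simp
      ultimately show "P \<in> ?g ` ?X" by blast
    qed
  qed
qed

section \<open>Recurrence in \<nu> and downward induction\<close>

lemma card_staircase_partitions:
  assumes "0 < a" "0 < m"
  shows "int (card (staircase_partitions a m \<nu> n)) = p_shift n (staircase a m \<nu>)"
proof (induction \<nu> arbitrary: n)
  case 0
  then show ?case by (simp add: staircase_partitions_def staircase_def p_shift_def p_def)
next
  case (Suc \<nu>)
  let ?y = "a + m * \<nu>" and ?A = "\<lambda>P. \<forall>j<\<nu>. a + m * j \<in># P"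
  have S: "staircase_partitions a m (Suc \<nu>) n = {P \<in> partitions n. ?A P \<and> ?y \<in># P}"
    by (auto simp: staircase_partitions_def less_Suc_eq)
  have sc: "staircase a m (Suc \<nu>) = staircase a m \<nu> + ?y"
    by (simp add: staircase_def)
  show ?case
  proof (cases "?y \<le> n")
    case True
    have "?A (add_mset ?y P) = ?A P" for P
      using \<open>0 < m\<close> by auto
    \<comment> \<open>One copy of the largest prescribed part is deleted; the smaller prescribed
      parts are different from it and survive.\<close>
    then have "card {P \<in> partitions (n - ?y). ?A P} = card {P \<in> partitions (n - ?y + ?y). ?A P \<and> ?y \<in># P}"
      using \<open>0 < a\<close> by (intro bij_betw_same_card[OF bij_betw_add_part]) auto
    then have "card (staircase_partitions a m (Suc \<nu>) n) = card (staircase_partitions a m \<nu> (n - ?y))"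
      using True by (simp add: S) (simp add: staircase_partitions_def)
    then show ?thesis using Suc.IH[of "n - ?y"] True
      by (auto simp: p_shift_def sc add.commute)
  next
    case False
    then have "staircase_partitions a m (Suc \<nu>) n = {}"
      unfolding S using part_le by blast
    then show ?thesis using False by (simp add: p_shift_def sc)
  qed
qed

text \<open>Both bijections start from the same \<open>split_pairs\<close>, so the staircase
  partitions outside \<open>M_type a m \<nu> n\<close> are equinumerous with
  \<open>M_type a m (Suc \<nu>) n\<close>.\<close>

lemma card_M_type_Suc:
  assumes "0 < a" "0 < m"
  shows "int (card (M_type a m \<nu> n)) + int (card (M_type a m (Suc \<nu>) n)) = p_shift n (staircase a m (Suc \<nu>))"
proof -
  have "card (M_type a m (Suc \<nu>) n) = card (no_durfee a m (Suc \<nu>) n)"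
    using bij_betw_same_card[OF bij_betw_M_type[OF assms]] bij_betw_same_card[OF bij_betw_no_durfee[OF assms]]
    by metis
  moreover have split: "staircase_partitions a m (Suc \<nu>) n = M_type a m \<nu> n \<union> no_durfee a m (Suc \<nu>) n"
    by (auto simp: staircase_partitions_def M_type_def no_durfee_def less_Suc_eq_le)
  have "card (staircase_partitions a m (Suc \<nu>) n) = card (M_type a m \<nu> n) + card (no_durfee a m (Suc \<nu>) n)"
    unfolding split using finite_partitions
    by (intro card_Un_disjoint) (auto simp: staircase_partitions_def M_type_def no_durfee_def)
  ultimately show ?thesis
    using card_staircase_partitions[OF assms, of "Suc \<nu>" n] by simp
qed

lemma M_type_empty:
  assumes "0 < a" "0 < m" "n \<le> \<nu>"
  shows "M_type a m \<nu> n = {}"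
proof -
  have False if "P \<in> M_type a m \<nu> n" for P
  proof -
    have "a + m * \<nu> \<le> n"
      using that by (intro part_le[of P]) (simp_all add: M_type_def)
    moreover have "\<nu> \<le> m * \<nu>" using assms by simp
    ultimately show False using assms by simp
  qed
  then show ?thesis by blast
qed

text \<open>The values of either side at \<open>\<nu>\<close> and \<open>Suc \<nu>\<close> add up to
  the same two \<open>p_shift\<close> terms, and both sides vanish at
  \<open>\<nu> = n\<close>.\<close>

lemma truncated_pentagonal:
  assumes "n \<ge> 1" "\<nu> \<le> n"
  shows "(-1) ^ \<nu> * pent_partial n \<nu> = int (card (M_type 1 3 \<nu> n) + card (M_type 2 3 \<nu> n))"
  using assms(2)
proof (induction rule: inc_induct)
  case base
  then show ?case using pentagonal_recurrence[OF assms(1)] by (simp add: M_type_empty)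
next
  case (step \<nu>)
  have "pent_partial n (Suc \<nu>) = pent_partial n \<nu> +
      (-1) ^ Suc \<nu> * (p_shift n (staircase 1 3 (Suc \<nu>)) + p_shift n (staircase 2 3 (Suc \<nu>)))"
    by (simp add: pent_partial_def)
  then have "(-1) ^ Suc \<nu> * pent_partial n (Suc \<nu>) = - ((-1) ^ \<nu> * pent_partial n \<nu>) +
      (p_shift n (staircase 1 3 (Suc \<nu>)) + p_shift n (staircase 2 3 (Suc \<nu>)))"
    by (cases "even \<nu>") auto
  then show ?case
    using step.IH card_M_type_Suc[of 1 3 \<nu> n] card_M_type_Suc[of 2 3 \<nu> n] by simp
qed

section \<open>Translation to the explicit pentagonal exponents\<close>

lemma staircase_1_3_Suc: "staircase (Suc 0) 3 (Suc k) = k * (3 * k + 5) div 2 + 1"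
  using double_staircase[of 1 3 "Suc k"] by (simp add: algebra_simps)

lemma staircase_2_3: "staircase 2 3 k = k * (3 * k + 1) div 2"
  using double_staircase[of 2 3 k] by (simp add: algebra_simps)

theorem theorem1p3:
  fixes \<nu> n :: nat
  assumes "\<nu> \<ge> 1" and "n > \<nu> * (3 * \<nu> + 5) div 2"
  shows "(-1) ^ \<nu> *
      ((\<Sum>\<tau> = 0..\<nu>. (-1) ^ \<tau> * int (p (n - \<tau> * (3 * \<tau> + 1) div 2)))
       - (\<Sum>\<tau> = 0..\<nu> - 1. (-1) ^ \<tau> * int (p (n - \<tau> * (3 * \<tau> + 5) div 2 - 1))))
    = int (p_res 2 3 \<nu> n + p_res 1 3 \<nu> n)"
proof -
  \<comment> \<open>With \<open>bound'\<close>, this makes every subtraction in the two sums exact,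
    so that each term is a \<open>p_shift\<close>.\<close>
  have bound: "k * (3 * k + 5) div 2 + 1 \<le> n" if "k \<le> \<nu>" for k
  proof -
    have "k * (3 * k + 5) \<le> \<nu> * (3 * \<nu> + 5)" using that by (intro mult_mono) auto
    then have "k * (3 * k + 5) div 2 \<le> \<nu> * (3 * \<nu> + 5) div 2" by (rule div_le_mono)
    then show ?thesis using assms(2) by simp
  qed
  have bound': "k * (3 * k + 1) div 2 \<le> n" if "k \<le> \<nu>" for k
  proof -
    have "k * (3 * k + 1) div 2 \<le> k * (3 * k + 5) div 2" by (intro div_le_mono mult_mono) auto
    then show ?thesis using bound[OF that] by simp
  qed
  have "\<nu> \<le> n"
    using bound[of \<nu>] by (simp add: algebra_simps)
  have s1: "(\<Sum>\<tau> = 0..\<nu>. (-1) ^ \<tau> * int (p (n - \<tau> * (3 * \<tau> + 1) div 2))) =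
      p_shift n 0 + (\<Sum>s=1..\<nu>. (-1) ^ s * p_shift n (staircase 2 3 s))"
    using bound' by (simp add: sum.atLeast_Suc_atMost p_shift_def staircase_2_3)
  \<comment> \<open>The index shift \<open>s = Suc \<tau>\<close> produces the minus sign in front
    of the second sum.\<close>
  have "(\<Sum>s=1..\<nu>. (-1) ^ s * p_shift n (staircase 1 3 s)) =
      (\<Sum>\<tau>=0..\<nu> - 1. (-1) ^ Suc \<tau> * p_shift n (staircase 1 3 (Suc \<tau>)))"
    using sum.shift_bounds_cl_Suc_ivl[of "\<lambda>s. (-1) ^ s * p_shift n (staircase 1 3 s)" 0 "\<nu> - 1"] assms(1)
    by simp
  also have "\<dots> = (\<Sum>\<tau> = 0..\<nu> - 1. - ((-1) ^ \<tau> * int (p (n - \<tau> * (3 * \<tau> + 5) div 2 - 1))))"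
  proof (rule sum.cong[OF refl])
    fix \<tau> assume "\<tau> \<in> {0..\<nu> - 1}"
    then have "staircase 1 3 (Suc \<tau>) \<le> n" using bound[of \<tau>] assms(1) by (simp add: staircase_1_3_Suc)
    then show "(-1) ^ Suc \<tau> * p_shift n (staircase 1 3 (Suc \<tau>)) =
        - ((-1) ^ \<tau> * int (p (n - \<tau> * (3 * \<tau> + 5) div 2 - 1)))"
      by (simp add: p_shift_def staircase_1_3_Suc)
  qed
  finally have "(\<Sum>\<tau> = 0..\<nu>. (-1) ^ \<tau> * int (p (n - \<tau> * (3 * \<tau> + 1) div 2)))
       - (\<Sum>\<tau> = 0..\<nu> - 1. (-1) ^ \<tau> * int (p (n - \<tau> * (3 * \<tau> + 5) div 2 - 1))) = pent_partial n \<nu>"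
    unfolding s1 by (simp add: pent_partial_def sum_negf sum.distrib distrib_left)
  then show ?thesis
    using truncated_pentagonal[OF _ \<open>\<nu> \<le> n\<close>] assms(1) \<open>\<nu> \<le> n\<close>
    by (simp add: p_res_eq_card_M_type)
qed

end
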